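(* Let $N\ge 1$, $H\in\mathbb{R}^{N\times N}$, $d\in\mathbb{R}^N$, and let $\Phi_i(u_i,y_i)=\Phi_i^{(1)}(u_i)+\Phi_i^{(2)}(y_i)$, $i=1,\dots,N$, where each $\Phi_i^{(1)}:\mathbb{R}\to\mathbb{R}$ is continuously differentiable, $L_u$-smooth and $m_u$-strongly convex, and each $\Phi_i^{(2)}:\mathbb{R}\to\mathbb{R}$ is continuously differentiable, $L_y$-smooth and $m_y$-strongly convex. Let $\Phi(u,y)=\sum_{i=1}^N\Phi_i(u_i,y_i)$. Consider the decentralized controller $$u_{k+1}=u_k-\eta\left(\nabla_u\Phi(u_k,y_k)+H_{\text{diag}}^{\top}\nabla_y\Phi(u_k,y_k)\right),\qquad \eta>0.$$ Then its stationary points $u_\infty\in\mathbb{R}^N$, if they exist, coincide with the Nash equilibria of the convex game in which every agent $i\in\{1,\dots,N\}$ chooses $u_i\in\mathbb{R}$ to solve $$\min_{u_i}\ \tilde\Phi_i(u),\qquad \tilde\Phi_i(u)=\Phi_i\big(u_i,(Hu+d)_i\big).$$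
   Context: $H_{\text{diag}}$ is the diagonal matrix with the diagonal elements of $H$. The constants satisfy $m_u,m_y>0$; "$L$-smooth" means the gradient is $L$-Lipschitz. The plant has steady-state input-output map $y=Hu+d$; a stationary point of the controller is a vector $u_\infty$ that is a fixed point of the update when the output is at steady state, $y=Hu_\infty+d$. A Nash equilibrium is a $u\in\mathbb{R}^N$ such that, for each $i$, $u_i$ minimizes $v\mapsto\tilde\Phi_i(u_1,\dots,u_{i-1},v,u_{i+1},\dots,u_N)$ over $v\in\mathbb{R}$. *)

theory Defs
  imports "HOL-Analysis.Analysis"
begin

(* Meaningful only where f is differentiable at x; see gradient_eqI. *)
definition gradient :: "('a::real_inner \<Rightarrow> real) \<Rightarrow> 'a \<Rightarrow> 'a" where
  "gradient f x = (THE g. GDERIV f x :> g)"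

lemma gradient_eqI:
  assumes "GDERIV f x :> g"
  shows "gradient f x = g"
  unfolding gradient_def
proof (rule the_equality[where P = "\<lambda>g. GDERIV f x :> g"])
  show "GDERIV f x :> g" by (fact assms)
  fix g' assume "GDERIV f x :> g'"
  then have "(\<lambda>h. h \<bullet> g') = (\<lambda>h. h \<bullet> g)"
    using assms unfolding gderiv_def by (rule has_derivative_unique)
  then have "h \<bullet> g' = h \<bullet> g" for h by (rule fun_cong)
  then show "g' = g" by (metis inner_commute vector_eq_rdot)
qed

definition L_smooth :: "real \<Rightarrow> ('a::real_inner \<Rightarrow> real) \<Rightarrow> bool" where
  "L_smooth L f \<longleftrightarrow> f differentiable_on UNIV \<and> L-lipschitz_on UNIV (gradient f)"

definition strongly_convex :: "real \<Rightarrow> ('a::real_normed_vector \<Rightarrow> real) \<Rightarrow> bool" where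
  "strongly_convex m f \<longleftrightarrow>
     (\<forall>x y. \<forall>s\<ge>0. \<forall>t\<ge>0. s + t = 1 \<longrightarrow>
        f (s *\<^sub>R x + t *\<^sub>R y) \<le> s * f x + t * f y - m / 2 * s * t * (norm (x - y))\<^sup>2)"

definition diag_part :: "real^'n^'n \<Rightarrow> real^'n^'n" where
  "diag_part H = (\<chi> i j. if i = j then H $ i $ j else 0)"

definition total_cost ::
    "('n \<Rightarrow> real \<Rightarrow> real \<Rightarrow> real) \<Rightarrow> real^'n \<Rightarrow> real^'n \<Rightarrow> real" where
  "total_cost \<Phi> u y = (\<Sum>i\<in>UNIV. \<Phi> i (u $ i) (y $ i))"

definition controller_update ::
    "real \<Rightarrow> real^'n^'n \<Rightarrow> ('n \<Rightarrow> real \<Rightarrow> real \<Rightarrow> real) \<Rightarrow> real^'n \<Rightarrow> real^'n \<Rightarrow> real^'n" where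
  "controller_update \<eta> H \<Phi> u y =
     u - \<eta> *\<^sub>R (gradient (\<lambda>u'. total_cost \<Phi> u' y) u
              + transpose (diag_part H) *v gradient (\<lambda>y'. total_cost \<Phi> u y') y)"

definition steady_state_output :: "real^'n^'n \<Rightarrow> real^'n \<Rightarrow> real^'n \<Rightarrow> real^'n" where
  "steady_state_output H d u = H *v u + d"

definition stationary_point ::
    "real \<Rightarrow> real^'n^'n \<Rightarrow> real^'n \<Rightarrow> ('n \<Rightarrow> real \<Rightarrow> real \<Rightarrow> real) \<Rightarrow> real^'n \<Rightarrow> bool" where
  "stationary_point \<eta> H d \<Phi> u \<longleftrightarrow>
     controller_update \<eta> H \<Phi> u (steady_state_output H d u) = u"

definition deviate :: "real^'n \<Rightarrow> 'n \<Rightarrow> real \<Rightarrow> real^'n" where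
  "deviate u i v = (\<chi> j. if j = i then v else u $ j)"

definition convex_game :: "('n \<Rightarrow> real^'n \<Rightarrow> real) \<Rightarrow> bool" where
  "convex_game J \<longleftrightarrow> (\<forall>i u. convex_on UNIV (\<lambda>v. J i (deviate u i v)))"

definition nash_equilibrium :: "('n \<Rightarrow> real^'n \<Rightarrow> real) \<Rightarrow> real^'n \<Rightarrow> bool" where
  "nash_equilibrium J u \<longleftrightarrow>
     (\<forall>i. is_arg_min (\<lambda>v. J i (deviate u i v)) (\<lambda>v. v \<in> UNIV) (u $ i))"

definition agent_cost ::
    "real^'n^'n \<Rightarrow> real^'n \<Rightarrow> ('n \<Rightarrow> real \<Rightarrow> real \<Rightarrow> real) \<Rightarrow> 'n \<Rightarrow> real^'n \<Rightarrow> real" where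
  "agent_cost H d \<Phi> i u = \<Phi> i (u $ i) (steady_state_output H d u $ i)"

end

theory Submission
  imports Defs
begin

text \<open>
  Component \<open>i\<close> of the update direction at the steady state \<open>y = H u + d\<close> is
  \<open>\<Phi>\<^sub>i\<^sup>(\<^sup>1\<^sup>)'(u\<^sub>i) + H\<^sub>i\<^sub>i \<Phi>\<^sub>i\<^sup>(\<^sup>2\<^sup>)'(y\<^sub>i)\<close>, which is exactly the derivative of agent \<open>i\<close>'s cost along its own
  decision, because a unilateral deviation \<open>v - u\<^sub>i\<close> moves \<open>y\<^sub>i\<close> by \<open>H\<^sub>i\<^sub>i (v - u\<^sub>i)\<close>. The cost is
  convex in that decision, so the derivative vanishes exactly at the minimisers.
\<close>

lemma strongly_convex_imp_convex_on:
  assumes "strongly_convex m f" "m \<ge> 0"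
  shows "convex_on UNIV f"
  unfolding convex_on_def
proof (intro conjI ballI allI impI)
  fix x y and s t :: real
  assume st: "0 \<le> s" "0 \<le> t" "s + t = 1"
  then have "f (s *\<^sub>R x + t *\<^sub>R y) \<le> s * f x + t * f y - m / 2 * s * t * (norm (x - y))\<^sup>2"
    using assms(1) unfolding strongly_convex_def by blast
  moreover have "0 \<le> m / 2 * s * t * (norm (x - y))\<^sup>2"
    using st assms(2) by simp
  ultimately show "f (s *\<^sub>R x + t *\<^sub>R y) \<le> s * f x + t * f y"
    by linarith
qed simp

text \<open>Affine maps commute with convex combinations. The form \<open>c + a * (v - b)\<close> is
  that of an agent's output as a function of its own decision.\<close>

lemma convex_on_affine_compose:
  fixes f :: "real \<Rightarrow> real"
  assumes "convex_on UNIV f"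
  shows "convex_on UNIV (\<lambda>v. f (c + a * (v - b)))"
  unfolding convex_on_def
proof (intro conjI ballI allI impI)
  fix x y s t :: real
  assume st: "0 \<le> s" "0 \<le> t" "s + t = 1"
  \<comment> \<open>Weighting the constants \<open>c\<close> and \<open>b\<close> by
    \<open>s + t = 1\<close> makes the rest a polynomial identity.\<close>
  have "c + a * (s *\<^sub>R x + t *\<^sub>R y - b)
      = (s + t) * c + a * (s * x + t * y - (s + t) * b)"
    using st by simp
  also have "\<dots> = s *\<^sub>R (c + a * (x - b)) + t *\<^sub>R (c + a * (y - b))"
    by (simp add: algebra_simps)
  finally show "f (c + a * (s *\<^sub>R x + t *\<^sub>R y - b))
      \<le> s * f (c + a * (x - b)) + t * f (c + a * (y - b))"
    using assms st unfolding convex_on_def by simp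
qed simp

text \<open>One direction is Fermat's rule. For the other, a convex function lies above its tangent,
  which is horizontal when \<open>D = 0\<close>.\<close>

lemma convex_on_global_min_iff_deriv_zero:
  fixes f :: "real \<Rightarrow> real"
  assumes "convex_on UNIV f" and deriv: "(f has_real_derivative D) (at x)"
  shows "(\<forall>y. f x \<le> f y) \<longleftrightarrow> D = 0"
proof
  assume "\<forall>y. f x \<le> f y"
  then show "D = 0"
    using DERIV_local_min[OF deriv zero_less_one] by blast
next
  assume "D = 0"
  show "\<forall>y. f x \<le> f y"
  proof
    fix y
    have "f y - f x \<ge> D * (y - x)"
      using assms by (intro convex_on_imp_above_tangent[of UNIV]) auto
    then show "f x \<le> f y" using \<open>D = 0\<close> by simp
  qed
qed

text \<open>Each summand sees one coordinate only, so the total derivative is the inner product with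
  the vector of scalar derivatives. This yields both gradients of \<open>total_cost\<close>.\<close>

lemma GDERIV_separable_sum:
  fixes x :: "real^'n"
  assumes "\<And>i. (f i has_real_derivative f' i) (at (x $ i))"
  shows "GDERIV (\<lambda>x. \<Sum>i\<in>UNIV. f i (x $ i)) x :> (\<chi> i. f' i)"
proof -
  have "((\<lambda>x. f i (x $ i)) has_derivative (\<lambda>h. f' i * h $ i)) (at x)" for i
    using has_derivative_compose[OF bounded_linear_imp_has_derivative[OF bounded_linear_vec_nth]
        assms[of i, unfolded has_field_derivative_def]]
    by simp
  then have "((\<lambda>x. \<Sum>i\<in>UNIV. f i (x $ i)) has_derivative (\<lambda>h. \<Sum>i\<in>UNIV. f' i * h $ i)) (at x)"
    by (intro has_derivative_sum)
  then show ?thesis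
    by (simp add: gderiv_def inner_vec_def mult.commute)
qed

text \<open>The deviation is a multiple of the unit vector \<open>axis i 1\<close>, which
  \<open>H\<close> maps to its column \<open>i\<close>. Only the diagonal entry of that column
  reaches output \<open>i\<close>, whence \<open>diag_part H\<close> in the controller.\<close>

lemma steady_state_output_deviate:
  "steady_state_output H d (deviate u i v) $ i
    = steady_state_output H d u $ i + H $ i $ i * (v - u $ i)"
proof -
  have "deviate u i v = u + (v - u $ i) *\<^sub>R axis i 1"
    by (simp add: deviate_def vec_eq_iff axis_def)
  then show ?thesis
    by (simp add: steady_state_output_def matrix_vector_right_distrib matrix_vector_mult_scaleR
        matrix_vector_mult_basis column_def)
qed

lemma transpose_diag_part_mult: "(transpose (diag_part H) *v g) $ i = H $ i $ i * g $ i"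
  by (simp add: matrix_vector_mult_def transpose_def diag_part_def if_distrib[of "\<lambda>x. x * _"]
      cong: if_cong)

theorem theorem3p1:
  fixes H :: "real^'n^'n"
    and d :: "real^'n"
    and \<Phi>1 \<Phi>2 :: "'n \<Rightarrow> real \<Rightarrow> real"
    and \<Phi> :: "'n \<Rightarrow> real \<Rightarrow> real \<Rightarrow> real"
    and L_u L_y m_u m_y \<eta> :: real
  assumes "m_u > 0" and "m_y > 0" and "\<eta> > 0"
    and "\<And>i. \<Phi>1 i C1_differentiable_on UNIV"
    and "\<And>i. L_smooth L_u (\<Phi>1 i)"
    and "\<And>i. strongly_convex m_u (\<Phi>1 i)"
    and "\<And>i. \<Phi>2 i C1_differentiable_on UNIV"
    and "\<And>i. L_smooth L_y (\<Phi>2 i)"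
    and "\<And>i. strongly_convex m_y (\<Phi>2 i)"
    and "\<And>i a b. \<Phi> i a b = \<Phi>1 i a + \<Phi>2 i b"
  shows "convex_game (agent_cost H d \<Phi>) \<and>
         {u. stationary_point \<eta> H d \<Phi> u} = {u. nash_equilibrium (agent_cost H d \<Phi>) u}"
proof -
  note \<Phi>_eq = assms(10)
  have d1: "(\<Phi>1 i has_real_derivative deriv (\<Phi>1 i) x) (at x)"
    and d2: "(\<Phi>2 i has_real_derivative deriv (\<Phi>2 i) x) (at x)" for i x
    using assms(5,8) unfolding L_smooth_def differentiable_on_def
    by (auto simp: DERIV_deriv_iff_real_differentiable)
  have cost: "agent_cost H d \<Phi> i (deviate u i v)
      = \<Phi>1 i v + \<Phi>2 i (steady_state_output H d u $ i + H $ i $ i * (v - u $ i))" for i u v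
    \<comment> \<open>\<open>deviate\<close> stays folded until the output has been rewritten; only
      then is its own entry evaluated.\<close>
    by (simp add: agent_cost_def \<Phi>_eq steady_state_output_deviate) (simp add: deviate_def)
  have conv: "convex_on UNIV (\<lambda>v. agent_cost H d \<Phi> i (deviate u i v))" for i u
    unfolding cost using assms(1,2)
    by (intro convex_on_add convex_on_affine_compose
        strongly_convex_imp_convex_on[OF assms(6)] strongly_convex_imp_convex_on[OF assms(9)]) auto
  define G where "G i u = deriv (\<Phi>1 i) (u $ i)
      + H $ i $ i * deriv (\<Phi>2 i) (steady_state_output H d u $ i)" for i u
  have cost_deriv: "((\<lambda>v. agent_cost H d \<Phi> i (deviate u i v)) has_real_derivative G i u)
      (at (u $ i))" for i u
  proof -
    let ?y = "steady_state_output H d u $ i"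
    have "((\<lambda>v. ?y + H $ i $ i * (v - u $ i)) has_real_derivative H $ i $ i) (at (u $ i))"
      by (auto intro!: derivative_eq_intros)
    \<comment> \<open>At \<open>v = u $ i\<close> the inner affine map takes the value
      \<open>?y\<close>, so the chain rule uses \<open>d2\<close> there.\<close>
    then have "((\<lambda>v. \<Phi>2 i (?y + H $ i $ i * (v - u $ i))) has_real_derivative
        deriv (\<Phi>2 i) ?y * H $ i $ i) (at (u $ i))"
      using DERIV_chain2[where f = "\<Phi>2 i"] d2[of i ?y] by simp
    from DERIV_add[OF d1 this] show ?thesis
      unfolding cost G_def by (simp add: mult.commute)
  qed
  have nash: "nash_equilibrium (agent_cost H d \<Phi>) u \<longleftrightarrow> (\<forall>i. G i u = 0)" for u
    using convex_on_global_min_iff_deriv_zero[OF conv cost_deriv]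
    by (simp add: nash_equilibrium_def is_arg_min_linorder)
  have stat: "stationary_point \<eta> H d \<Phi> u \<longleftrightarrow> (\<forall>i. G i u = 0)" for u
  proof -
    let ?y = "steady_state_output H d u"
    \<comment> \<open>With the output frozen at \<open>?y\<close>, the \<open>\<Phi>2\<close> terms
      are constants and contribute nothing.\<close>
    have "gradient (\<lambda>u'. total_cost \<Phi> u' ?y) u = (\<chi> i. deriv (\<Phi>1 i) (u $ i))"
      unfolding total_cost_def \<Phi>_eq
      by (intro gradient_eqI GDERIV_separable_sum)
        (auto intro!: derivative_eq_intros d1)
    moreover have "gradient (\<lambda>y'. total_cost \<Phi> u y') ?y = (\<chi> i. deriv (\<Phi>2 i) (?y $ i))"
      unfolding total_cost_def \<Phi>_eq
      by (intro gradient_eqI GDERIV_separable_sum)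
        (auto intro!: derivative_eq_intros d2)
    \<comment> \<open>A fixed point means that \<open>\<eta>\<close> times the direction is zero,
      and \<open>\<eta>\<close> cancels. The deleted simp rule would turn the transposed product
      into \<open>v*\<close> before \<open>transpose_diag_part_mult\<close> could match.\<close>
    ultimately show ?thesis
      using \<open>\<eta> > 0\<close>
      by (simp add: stationary_point_def controller_update_def vec_eq_iff
          transpose_diag_part_mult G_def del: transpose_matrix_vector)
  qed
  show ?thesis
    using conv nash stat by (simp add: convex_game_def)
qed

end
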